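(* Let $F_1$, $F_2$ and $G$ be distributions on $\mathbb{R}$ such that $F_1$ and $F_2$ are tail equivalent. If $G$ is long-tailed, then the distributions $F_1*G$ and $F_2*G$ are tail equivalent.
   Context: A distribution is a (Borel) probability measure on $\mathbb{R}$; its tail function is $\overline{F}(x)=F((x,\infty))$. The convolution $F*G$ has tail $\overline{F*G}(x)=\int_{-\infty}^\infty \overline{F}(x-y)\,G(dy)$. The notation $f(x)\sim g(x)$ as $x\to\infty$ means $f(x)/g(x)\to 1$. Two distributions $F_1,F_2$ on $\mathbb{R}$ are tail equivalent if $\overline{F_1}(x)\sim\overline{F_2}(x)$ as $x\to\infty$. A distribution $G$ on $\mathbb{R}$ is long-tailed if $\overline{G}(x)>0$ for all $x$ and, for every constant $a\in\mathbb{R}$, $\overline{G}(x+a)\sim\overline{G}(x)$ as $x\to\infty$. *)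

theory Defs
  imports "HOL-Probability.Probability" "HOL-Library.Landau_Symbols"
begin

definition tail :: "real measure \<Rightarrow> real \<Rightarrow> real" where
  "tail F x = measure F {x<..}"

text \<open>
  The quotient itself has to tend to 1. As \<open>u / 0 = 0\<close>, this forces \<open>f\<close> and \<open>g\<close> to be
  eventually nonzero. In contrast, the library relation \<open>f \<sim>[at_top] g\<close> also holds when
  both functions eventually vanish (see \<open>sim_at_top_iff\<close> below).
\<close>

definition sim_at_top :: "(real \<Rightarrow> real) \<Rightarrow> (real \<Rightarrow> real) \<Rightarrow> bool" where
  "sim_at_top f g \<longleftrightarrow> ((\<lambda>x. f x / g x) \<longlongrightarrow> 1) at_top"

definition tail_equivalent :: "real measure \<Rightarrow> real measure \<Rightarrow> bool" where
  "tail_equivalent F1 F2 \<longleftrightarrow> sim_at_top (tail F1) (tail F2)"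

definition long_tailed :: "real measure \<Rightarrow> bool" where
  "long_tailed G \<longleftrightarrow>
     (\<forall>x. tail G x > 0) \<and> (\<forall>a. sim_at_top (\<lambda>x. tail G (x + a)) (tail G))"

lemma sim_at_top_iff:
  "sim_at_top f g \<longleftrightarrow> f \<sim>[at_top] g \<and> eventually (\<lambda>x. g x \<noteq> 0) at_top"
proof
  assume *: "sim_at_top f g"
  hence "eventually (\<lambda>x. f x / g x > 0) at_top"
    unfolding sim_at_top_def by (rule order_tendstoD) simp
  hence "eventually (\<lambda>x. g x \<noteq> 0) at_top"
    by eventually_elim auto
  with * show "f \<sim>[at_top] g \<and> eventually (\<lambda>x. g x \<noteq> 0) at_top"
    unfolding sim_at_top_def by (auto intro: asymp_equivI')
next
  assume *: "f \<sim>[at_top] g \<and> eventually (\<lambda>x. g x \<noteq> 0) at_top"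
  hence "((\<lambda>x. if f x = 0 \<and> g x = 0 then 1 else f x / g x) \<longlongrightarrow> 1) at_top"
    by (simp add: asymp_equiv_def)
  moreover from * have "eventually (\<lambda>x. (if f x = 0 \<and> g x = 0 then 1 else f x / g x) = f x / g x) at_top"
    by (auto elim: eventually_mono)
  ultimately show "sim_at_top f g"
    unfolding sim_at_top_def by (rule Lim_transform_eventually)
qed

text \<open>
  The library convolution \<open>F \<star> G\<close> is the law of the sum of independent variables with laws
  \<open>F\<close> and \<open>G\<close>; on real distributions it has the familiar integral formula for the tail.
\<close>

lemma tail_convolution:
  assumes "real_distribution F" "real_distribution G"
  shows "tail (F \<star> G) x = (\<integral>y. tail F (x - y) \<partial>G)"
proof -
  interpret F: real_distribution F by fact
  interpret G: real_distribution G by fact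
  interpret P: pair_prob_space F G ..
  have fin: "finite_measure F" "finite_measure G" by unfold_locales
  have meas: "(\<lambda>y. measure F {x - y<..}) \<in> borel_measurable G"
  proof -
    have "mono (\<lambda>y. measure F {x - y<..})"
      by (intro monoI F.finite_measure_mono) auto
    from borel_measurable_mono[OF this] show ?thesis by simp
  qed
  have "emeasure (F \<star> G) {x<..} = emeasure (G \<star> F) {x<..}"
    using fin by (subst convolution_commutative) simp_all
  also have "\<dots> = (\<integral>\<^sup>+y. emeasure F {a. a + y \<in> {x<..}} \<partial>G)"
    using fin by (intro convolution_emeasure) auto
  also have "\<dots> = (\<integral>\<^sup>+y. ennreal (measure F {x - y<..}) \<partial>G)"
    by (intro nn_integral_cong, subst F.emeasure_eq_measure[symmetric])
       (auto intro!: arg_cong[where f = "emeasure F"])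
  finally show ?thesis
    using meas by (simp add: tail_def measure_def[of "F \<star> G"] integral_eq_nn_integral)
qed

end

theory Submission
  imports Defs
begin

text \<open>
  Write \<open>A\<^sub>i\<close> for the tail of \<open>F\<^sub>i\<close>, \<open>H\<^sub>i\<close> for that of \<open>F\<^sub>i \<star> G\<close> and \<open>T\<close> for that of \<open>G\<close>, so that
  \<open>H\<^sub>i x\<close> is the integral of \<open>A\<^sub>i (x - y)\<close> against \<open>G (dy)\<close>. The quotient \<open>A\<^sub>1 / A\<^sub>2\<close> tends to 1 not only at
  \<open>\<infinity>\<close>, where this is the hypothesis, but also at \<open>-\<infinity>\<close>, where both tails tend to 1. Hence, given
  \<open>\<epsilon> > 0\<close>, the bound \<open>\<bar>A\<^sub>1 t - A\<^sub>2 t\<bar> \<le> \<epsilon> A\<^sub>2 t\<close> fails only for \<open>t\<close> in some bounded interval \<open>(b, a)\<close>, and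
  there the difference of the tails is at most 1 anyway
  (\<open>tail_equivalent_imp_close_outside_interval\<close>). Integrating gives
  \<open>\<bar>H\<^sub>1 x - H\<^sub>2 x\<bar> \<le> \<epsilon> H\<^sub>2 x + (T (x - a) - T (x - b))\<close> (\<open>tail_convolution_diff_le\<close>).

  The last term is the mass that \<open>G\<close> puts on a window of fixed length travelling to \<open>\<infinity>\<close>. It is
  \<open>o(T x)\<close> because \<open>G\<close> is long-tailed, and \<open>T\<close> itself is \<open>O(H\<^sub>2)\<close>: a sum of independent variables
  exceeds \<open>x\<close> whenever the second does and the first is positive, so \<open>A\<^sub>2 0 * T x \<le> H\<^sub>2 x\<close>
  (\<open>tail_mult_le_tail_convolution\<close>). As \<open>\<epsilon>\<close> is arbitrary, \<open>H\<^sub>1 / H\<^sub>2\<close> tends to 1.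
\<close>

lemma tail_nonneg: "0 \<le> tail F x"
  by (simp add: tail_def)

lemma tail_antimono:
  assumes "real_distribution F" and "x \<le> y"
  shows "tail F y \<le> tail F x"
proof -
  interpret real_distribution F by fact
  show ?thesis
    unfolding tail_def using \<open>x \<le> y\<close> by (intro finite_measure_mono) auto
qed

lemma tail_le_1:
  assumes "real_distribution F"
  shows "tail F x \<le> 1"
proof -
  interpret real_distribution F by fact
  show ?thesis by (simp add: tail_def)
qed

lemma borel_measurable_tail [measurable]:
  assumes "real_distribution F"
  shows "tail F \<in> borel_measurable borel"
proof -
  have "mono (\<lambda>x. - tail F x)"
    using tail_antimono[OF assms] by (intro monoI) simp
  from borel_measurable_uminus[OF borel_measurable_mono[OF this]] show ?thesis
    by simp
qed

lemma tail_tendsto_1_at_bot: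
  assumes "real_distribution F"
  shows "(tail F \<longlongrightarrow> 1) at_bot"
proof -
  interpret real_distribution F by fact
  have "tail F x = 1 - cdf F x" for x
    using prob_compl[of "{..x}"] by (simp add: tail_def cdf_def Compl_eq_Diff_UNIV[symmetric])
  hence "tail F = (\<lambda>x. 1 - cdf F x)" ..
  moreover have "((\<lambda>x. 1 - cdf F x) \<longlongrightarrow> 1 - 0) at_bot"
    by (intro tendsto_diff tendsto_const cdf_lim_at_bot)
  ultimately show ?thesis by simp
qed

text \<open>
  A quotient with denominator 0 is 0, so tail equivalence forces the denominator to be nonzero
  arbitrarily far out; monotonicity carries this to every point.
\<close>

lemma tail_equivalent_imp_tail_pos:
  assumes "real_distribution F2" and "tail_equivalent F1 F2"
  shows "0 < tail F2 x"
proof -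
  have "eventually (\<lambda>y. tail F2 y \<noteq> 0) at_top"
    using assms(2) by (simp add: tail_equivalent_def sim_at_top_iff)
  then obtain y0 where "\<And>y. y0 \<le> y \<Longrightarrow> tail F2 y \<noteq> 0"
    by (auto simp: eventually_at_top_linorder)
  then obtain y where "y \<ge> x" "tail F2 y \<noteq> 0"
    using max.cobounded1 max.cobounded2 by blast
  with tail_antimono[OF assms(1), of x y] tail_nonneg[of F2 y] show ?thesis
    by linarith
qed

text \<open>
  The tail quotient is within \<open>\<epsilon>\<close> of 1 near both ends of the line: near \<open>\<infinity>\<close> by tail equivalence,
  near \<open>-\<infinity>\<close> because both tails are close to 1 there.
\<close>

lemma tail_equivalent_imp_close_outside_interval:
  assumes F1: "real_distribution F1" and F2: "real_distribution F2"
    and eq: "tail_equivalent F1 F2" and "\<epsilon> > 0"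
  obtains a b where "b \<le> a"
    and "\<And>t. t \<le> b \<or> a \<le> t \<Longrightarrow> \<bar>tail F1 t - tail F2 t\<bar> \<le> \<epsilon> * tail F2 t"
proof -
  have close: "\<bar>tail F1 t - tail F2 t\<bar> \<le> \<epsilon> * tail F2 t"
    if "dist (tail F1 t / tail F2 t) 1 < \<epsilon>" for t
  proof -
    have pos: "0 < tail F2 t" by (rule tail_equivalent_imp_tail_pos[OF F2 eq])
    have "\<bar>tail F1 t / tail F2 t - 1\<bar> * tail F2 t \<le> \<epsilon> * tail F2 t"
      using that pos by (intro mult_right_mono) (auto simp: dist_real_def)
    also have "\<bar>tail F1 t / tail F2 t - 1\<bar> * tail F2 t
      = \<bar>(tail F1 t / tail F2 t - 1) * tail F2 t\<bar>"
      using pos by (simp add: abs_mult)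
    also have "(tail F1 t / tail F2 t - 1) * tail F2 t = tail F1 t - tail F2 t"
      using pos by (simp add: field_simps)
    finally show ?thesis .
  qed
  have "((\<lambda>t. tail F1 t / tail F2 t) \<longlongrightarrow> 1) at_top"
    using eq by (simp add: tail_equivalent_def sim_at_top_def)
  from tendstoD[OF this \<open>\<epsilon> > 0\<close>] obtain a
    where a: "\<And>t. a \<le> t \<Longrightarrow> dist (tail F1 t / tail F2 t) 1 < \<epsilon>"
    by (auto simp: eventually_at_top_linorder)
  have "((\<lambda>t. tail F1 t / tail F2 t) \<longlongrightarrow> 1 / 1) at_bot"
    by (intro tendsto_divide tail_tendsto_1_at_bot F1 F2) simp
  hence "((\<lambda>t. tail F1 t / tail F2 t) \<longlongrightarrow> 1) at_bot" by simp
  from tendstoD[OF this \<open>\<epsilon> > 0\<close>] obtain b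
    where b: "\<And>t. t \<le> b \<Longrightarrow> dist (tail F1 t / tail F2 t) 1 < \<epsilon>"
    by (auto simp: eventually_at_bot_linorder)
  show ?thesis
    by (rule that[of "min a b" a]) (use a b close in auto)
qed

lemma integrable_tail_shift:
  assumes F: "real_distribution F" and G: "real_distribution G"
  shows "integrable G (\<lambda>y. tail F (x - y))"
proof -
  interpret G: real_distribution G by fact
  note borel_measurable_tail[OF F, measurable]
  show ?thesis
    by (rule G.integrable_const_bound[where B = 1])
       (auto simp: tail_le_1[OF F] tail_nonneg)
qed

lemma tail_convolution_diff_le:
  assumes F1: "real_distribution F1" and F2: "real_distribution F2"
    and G: "real_distribution G" and "b \<le> a" and "\<epsilon> > 0"
    and close: "\<And>t. t \<le> b \<or> a \<le> t \<Longrightarrow> \<bar>tail F1 t - tail F2 t\<bar> \<le> \<epsilon> * tail F2 t"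
  shows "\<bar>tail (F1 \<star> G) x - tail (F2 \<star> G) x\<bar>
    \<le> \<epsilon> * tail (F2 \<star> G) x + (tail G (x - a) - tail G (x - b))"
proof -
  interpret G: real_distribution G by fact
  note int = integrable_tail_shift[OF F1 G] integrable_tail_shift[OF F2 G]
  have ind: "integrable G (indicator {c<..} :: real \<Rightarrow> real)" for c
    by (simp add: G.emeasure_eq_measure)
  \<comment> \<open>The difference of indicators is the indicator of the window \<open>x - a < y \<le> x - b\<close>, which
    contains every \<open>y\<close> for which \<open>x - y\<close> lies strictly between \<open>b\<close> and \<open>a\<close>.\<close>
  have pointwise: "\<bar>tail F1 (x - y) - tail F2 (x - y)\<bar>
    \<le> \<epsilon> * tail F2 (x - y) + (indicator {x - a<..} y - indicator {x - b<..} y)" for y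
  proof (cases "x - y \<le> b \<or> a \<le> x - y")
    case True
    moreover have "indicator {x - b<..} y \<le> (indicator {x - a<..} y :: real)"
      using \<open>b \<le> a\<close> by (auto simp: indicator_def)
    ultimately show ?thesis
      using close[of "x - y"] by linarith
  next
    case False
    hence "indicator {x - a<..} y - indicator {x - b<..} y = (1 :: real)"
      by (auto simp: indicator_def)
    moreover have "0 \<le> \<epsilon> * tail F2 (x - y)"
      using \<open>\<epsilon> > 0\<close> by (simp add: tail_nonneg)
    moreover have "\<bar>tail F1 (x - y) - tail F2 (x - y)\<bar> \<le> 1"
      using tail_le_1[OF F1, of "x - y"] tail_le_1[OF F2, of "x - y"]
        tail_nonneg[of F1 "x - y"] tail_nonneg[of F2 "x - y"] by linarith
    ultimately show ?thesis by linarith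
  qed
  have "\<bar>tail (F1 \<star> G) x - tail (F2 \<star> G) x\<bar>
      = \<bar>\<integral>y. tail F1 (x - y) - tail F2 (x - y) \<partial>G\<bar>"
    by (simp add: tail_convolution F1 F2 G int)
  also have "\<dots> \<le> (\<integral>y. \<bar>tail F1 (x - y) - tail F2 (x - y)\<bar> \<partial>G)"
    by (rule integral_abs_bound)
  also have "\<dots> \<le> (\<integral>y. \<epsilon> * tail F2 (x - y)
      + (indicator {x - a<..} y - indicator {x - b<..} y) \<partial>G)"
    using pointwise by (intro integral_mono) (auto intro!: int ind)
  also have "\<dots> = \<epsilon> * tail (F2 \<star> G) x + (tail G (x - a) - tail G (x - b))"
    by (simp add: tail_convolution[OF F2 G] int ind tail_def[of G])
  finally show ?thesis .
qed

lemma tail_mult_le_tail_convolution: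
  assumes F: "real_distribution F" and G: "real_distribution G"
  shows "tail F 0 * tail G x \<le> tail (F \<star> G) x"
proof -
  interpret G: real_distribution G by fact
  have "tail F 0 * tail G x = (\<integral>y. tail F 0 * indicator {x<..} y \<partial>G)"
    by (simp add: tail_def[of G])
  also have "\<dots> \<le> (\<integral>y. tail F (x - y) \<partial>G)"
  proof (rule integral_mono)
    show "integrable G (\<lambda>y. tail F 0 * indicator {x<..} y)"
      by (simp add: G.emeasure_eq_measure)
    show "integrable G (\<lambda>y. tail F (x - y))"
      by (rule integrable_tail_shift[OF F G])
    show "tail F 0 * indicator {x<..} y \<le> tail F (x - y)" for y
      using tail_antimono[OF F, of "x - y" 0] by (auto simp: indicator_def tail_nonneg)
  qed
  also have "\<dots> = tail (F \<star> G) x"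
    by (simp add: tail_convolution F G)
  finally show ?thesis .
qed

lemma long_tailed_window_tendsto_0:
  assumes "long_tailed G"
  shows "((\<lambda>x. (tail G (x - a) - tail G (x - b)) / tail G x) \<longlongrightarrow> 0) at_top"
proof -
  have shift: "((\<lambda>x. tail G (x - c) / tail G x) \<longlongrightarrow> 1) at_top" for c
  proof -
    have "((\<lambda>x. tail G (x + - c) / tail G x) \<longlongrightarrow> 1) at_top"
      using assms unfolding long_tailed_def sim_at_top_def by blast
    thus ?thesis by simp
  qed
  from tendsto_diff[OF shift[of a] shift[of b]] show ?thesis
    by (simp add: diff_divide_distrib)
qed

theorem theorem5:
  fixes F1 F2 G :: "real measure"
  assumes "real_distribution F1" "real_distribution F2" "real_distribution G"
    and "tail_equivalent F1 F2"
    and "long_tailed G"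
  shows "tail_equivalent (F1 \<star> G) (F2 \<star> G)"
  unfolding tail_equivalent_def sim_at_top_def
proof (rule tendstoI)
  fix \<epsilon> :: real
  assume "\<epsilon> > 0"
  define H1 where "H1 = tail (F1 \<star> G)"
  define H2 where "H2 = tail (F2 \<star> G)"
  from \<open>\<epsilon> > 0\<close> have "\<epsilon> / 2 > 0" by simp
  obtain a b
    where "b \<le> a"
      and close: "\<And>t. t \<le> b \<or> a \<le> t \<Longrightarrow> \<bar>tail F1 t - tail F2 t\<bar> \<le> \<epsilon> / 2 * tail F2 t"
    by (rule tail_equivalent_imp_close_outside_interval[OF assms(1,2,4) \<open>\<epsilon> / 2 > 0\<close>])
      (rule that; blast)
  have c: "0 < tail F2 0"
    by (rule tail_equivalent_imp_tail_pos[OF assms(2,4)])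
  \<comment> \<open>Half of \<open>\<epsilon>\<close> pays for the part of the integral outside the window, half for the window
    itself; the factor \<open>tail F2 0\<close> converts from \<open>tail G\<close> to \<open>H2\<close>.\<close>
  have "0 < \<epsilon> / 2 * tail F2 0" using \<open>\<epsilon> > 0\<close> c by simp
  from order_tendstoD(2)[OF long_tailed_window_tendsto_0[OF assms(5)] this]
  have "\<forall>\<^sub>F x in at_top. (tail G (x - a) - tail G (x - b)) / tail G x < \<epsilon> / 2 * tail F2 0" .
  hence "\<forall>\<^sub>F x in at_top. dist (H1 x / H2 x) 1 < \<epsilon>"
  proof eventually_elim
    case (elim x)
    have G: "0 < tail G x" using assms(5) by (simp add: long_tailed_def)
    have H2: "tail F2 0 * tail G x \<le> H2 x"
      unfolding H2_def by (rule tail_mult_le_tail_convolution[OF assms(2,3)])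
    have pos: "0 < H2 x" using mult_pos_pos[OF c G] H2 by linarith
    have "tail G (x - a) - tail G (x - b) < \<epsilon> / 2 * tail F2 0 * tail G x"
      using elim G by (simp only: pos_divide_less_eq)
    also have "\<dots> = \<epsilon> / 2 * (tail F2 0 * tail G x)" by simp
    also have "\<dots> \<le> \<epsilon> / 2 * H2 x"
      using H2 \<open>\<epsilon> > 0\<close> by (intro mult_left_mono) auto
    finally have "tail G (x - a) - tail G (x - b) < \<epsilon> / 2 * H2 x" .
    moreover have "\<bar>H1 x - H2 x\<bar> \<le> \<epsilon> / 2 * H2 x + (tail G (x - a) - tail G (x - b))"
      unfolding H1_def H2_def
      by (rule tail_convolution_diff_le[OF assms(1-3) \<open>b \<le> a\<close> \<open>\<epsilon> / 2 > 0\<close> close])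
    ultimately have "\<bar>H1 x - H2 x\<bar> < \<epsilon> * H2 x" by linarith
    moreover have "dist (H1 x / H2 x) 1 = \<bar>H1 x - H2 x\<bar> / H2 x"
    proof -
      have "H1 x / H2 x - 1 = (H1 x - H2 x) / H2 x" using pos by (simp add: field_simps)
      thus ?thesis using pos by (simp add: dist_real_def)
    qed
    ultimately show ?case using pos by (simp only: pos_divide_less_eq)
  qed
  thus "\<forall>\<^sub>F x in at_top. dist (tail (F1 \<star> G) x / tail (F2 \<star> G) x) 1 < \<epsilon>"
    by (simp add: H1_def H2_def)
qed

end
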